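(* Let $(H,d)$ be a locally compact Hadamard space and $f:H\to\mathbb{R}$ a geodesically differentiable function such that, for each $x\in H$, $f'(x;\gamma)$ is continuous in $\gamma\in\Gamma^c_x(H)$. Then, for each $x\in H$, $f'(x;\cdot)$ is bounded on closed bounded sets $U\subseteq\Gamma^c_x(H)$ (closed and bounded in $(\Gamma_x(H),d_1)$), and there are $\gamma_{\max},\gamma_{\min}\in\mathbb{S}(e_x)$ such that $f'(x;\gamma_{\max})=\sup_{\gamma\in\mathbb{S}(e_x)}f'(x;\gamma)$ and $f'(x;\gamma_{\min})=\inf_{\gamma\in\mathbb{S}(e_x)}f'(x;\gamma)$.
   Context: A Hadamard space is a complete $\mathrm{CAT}(0)$ space. For $x\in H$, $\Gamma_x(H)$ is the set of all constant speed geodesics $\gamma:[0,1]\to H$ (i.e. $d(\gamma(s),\gamma(t))=|s-t|\,d(\gamma(0),\gamma(1))$ for all $s,t\in[0,1]$) with $\gamma(0)=x$, equipped with the metric $d_1(\gamma,\eta):=\sup_{t\in[0,1]}d(\gamma(t),\eta(t))$. $e_x\in\Gamma_x(H)$ is the trivial (constant) geodesic at $x$, $\Gamma^c_x(H):=\Gamma_x(H)\setminus\{e_x\}$, and $\mathbb{S}(e_x):=\{\gamma\in\Gamma_x(H): d_1(\gamma,e_x)=1\}$ is the unit sphere in $\Gamma_x(H)$ centered at $e_x$. $f:H\to\mathbb{R}$ is geodesically differentiable at $x$ along $\gamma\in\Gamma^c_x(H)$ if the limit $$f'(x;\gamma):=\lim_{y\overset{\gamma}\to x}\frac{f(y)-f(x)}{d(y,x)}$$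 (as $y\to x$, $y\neq x$, along $\gamma$) exists; $f$ is geodesically differentiable at $x$ if this limit exists for all $\gamma\in\Gamma^c_x(H)$, and geodesically differentiable if this holds at every $x\in H$.
   Formalization: The existence of γ_max and γ_min is stated only for x with S(e_x) nonempty; if no geodesic of length 1 starts at x (e.g. H = [0,1/2]), S(e_x) is empty and the claim as written fails. *)

theory Defs
  imports "HOL-Analysis.Analysis"
begin

definition (in metric_space) const_speed_geodesic :: "(real \<Rightarrow> 'a) \<Rightarrow> bool" where
  "const_speed_geodesic \<gamma> \<longleftrightarrow>
     (\<forall>s\<in>{0..1}. \<forall>t\<in>{0..1}. dist (\<gamma> s) (\<gamma> t) = \<bar>s - t\<bar> * dist (\<gamma> 0) (\<gamma> 1))"

text \<open>
  The second class axiom compares points on the sides \<open>[p,q]\<close> and \<open>[p,r]\<close> of a geodesic triangle with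
  the corresponding points of a Euclidean comparison triangle \<open>p'\<close>, \<open>q'\<close>, \<open>r'\<close>. As any two distinct
  sides of a triangle share a vertex (and geodesics may be reversed), this covers all pairs of
  points on distinct sides; for two points on one side the comparison is an equality. The third
  side \<open>[q,r]\<close> need not be mentioned: it exists by the first axiom, and the comparison triangle
  depends only on the distances of the vertices.
\<close>

class cat0_space = metric_space +
  assumes geodesic_exists:
    "\<exists>\<gamma>. const_speed_geodesic \<gamma> \<and> \<gamma> 0 = x \<and> \<gamma> 1 = y"
  assumes cat0_comparison:
    "\<lbrakk>const_speed_geodesic \<gamma>; \<gamma> 0 = p; \<gamma> 1 = q;
      const_speed_geodesic \<eta>; \<eta> 0 = p; \<eta> 1 = r;
      Real_Vector_Spaces.dist (p' :: real^2) q' = dist p q;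
      Real_Vector_Spaces.dist q' r' = dist q r;
      Real_Vector_Spaces.dist p' r' = dist p r;
      s \<in> {0..1}; t \<in> {0..1}\<rbrakk>
     \<Longrightarrow> dist (\<gamma> s) (\<eta> t) \<le>
         Real_Vector_Spaces.dist ((1 - s) *\<^sub>R p' + s *\<^sub>R q') ((1 - t) *\<^sub>R p' + t *\<^sub>R r')"

class hadamard_space = cat0_space + complete_space

text \<open>
  Maps \<open>[0,1] \<rightarrow> H\<close> are represented as functions on the reals that are \<open>undefined\<close> outside
  \<open>[0,1]\<close>, so that equality of functions is equality of geodesics.
\<close>

definition geodesics_from :: "'a::metric_space \<Rightarrow> (real \<Rightarrow> 'a) set" where
  "geodesics_from x = {\<gamma> \<in> extensional {0..1}. const_speed_geodesic \<gamma> \<and> \<gamma> 0 = x}"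

text \<open>
  Constant speed geodesics on \<open>[0,1]\<close> are bounded, so the supremum below is taken over a set bounded
  from above; the value \<open>0\<close> for other arguments is arbitrary.
\<close>

definition geodesic_dist :: "(real \<Rightarrow> 'a::metric_space) \<Rightarrow> (real \<Rightarrow> 'a) \<Rightarrow> real" where
  "geodesic_dist \<gamma> \<eta> =
     (if const_speed_geodesic \<gamma> \<and> const_speed_geodesic \<eta>
      then (SUP t\<in>{0..1}. dist (\<gamma> t) (\<eta> t)) else 0)"

definition trivial_geodesic :: "'a \<Rightarrow> real \<Rightarrow> 'a" where
  "trivial_geodesic x = (\<lambda>t\<in>{0..1}. x)"

definition nonconst_geodesics_from :: "'a::metric_space \<Rightarrow> (real \<Rightarrow> 'a) set" where
  "nonconst_geodesics_from x = geodesics_from x - {trivial_geodesic x}"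

definition geodesic_unit_sphere :: "'a::metric_space \<Rightarrow> (real \<Rightarrow> 'a) set" where
  "geodesic_unit_sphere x = {\<gamma> \<in> geodesics_from x. geodesic_dist \<gamma> (trivial_geodesic x) = 1}"

lemma bdd_above_geodesic_dist:
  fixes \<gamma> \<eta> :: "real \<Rightarrow> 'a::metric_space"
  assumes "const_speed_geodesic \<gamma>" "const_speed_geodesic \<eta>"
  shows "bdd_above ((\<lambda>t. dist (\<gamma> t) (\<eta> t)) ` {0..1})"
proof (rule bdd_aboveI2)
  fix t :: real assume t: "t \<in> {0..1}"
  have le: "dist (\<sigma> t) (\<sigma> 0) \<le> dist (\<sigma> 0) (\<sigma> 1)"
    if "const_speed_geodesic \<sigma>" for \<sigma> :: "real \<Rightarrow> 'a"
  proof -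
    have "dist (\<sigma> t) (\<sigma> 0) = \<bar>t - 0\<bar> * dist (\<sigma> 0) (\<sigma> 1)"
      using that t unfolding const_speed_geodesic_def by (meson atLeastAtMost_iff order_refl zero_le_one)
    then show ?thesis
      using t by (simp add: mult_left_le_one_le)
  qed
  have "dist (\<gamma> t) (\<eta> t) \<le> dist (\<gamma> t) (\<gamma> 0) + dist (\<gamma> 0) (\<eta> 0) + dist (\<eta> t) (\<eta> 0)"
    by metric
  then show "dist (\<gamma> t) (\<eta> t) \<le> dist (\<gamma> 0) (\<gamma> 1) + dist (\<gamma> 0) (\<eta> 0) + dist (\<eta> 0) (\<eta> 1)"
    using le[OF assms(1)] le[OF assms(2)] by linarith
qed

lemma dist_le_geodesic_dist:
  assumes "const_speed_geodesic \<gamma>" "const_speed_geodesic \<eta>" "t \<in> {0..1}"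
  shows "dist (\<gamma> t) (\<eta> t) \<le> geodesic_dist \<gamma> \<eta>"
  using assms bdd_above_geodesic_dist[OF assms(1,2)]
  unfolding geodesic_dist_def by (auto intro: cSUP_upper2)

lemma Metric_space_geodesics_from: "Metric_space (geodesics_from x) geodesic_dist"
proof
  fix \<gamma> \<eta> :: "real \<Rightarrow> 'a"
  show "0 \<le> geodesic_dist \<gamma> \<eta>"
  proof (cases "const_speed_geodesic \<gamma> \<and> const_speed_geodesic \<eta>")
    case True
    then show ?thesis
      using dist_le_geodesic_dist[of \<gamma> \<eta> 0] order_trans[OF zero_le_dist] by auto
  qed (auto simp: geodesic_dist_def)
  show "geodesic_dist \<gamma> \<eta> = geodesic_dist \<eta> \<gamma>"
    by (simp add: geodesic_dist_def dist_commute)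
next
  fix \<gamma> \<eta> assume *: "\<gamma> \<in> geodesics_from x" "\<eta> \<in> geodesics_from x"
  then have g: "const_speed_geodesic \<gamma>" "const_speed_geodesic \<eta>"
    by (auto simp: geodesics_from_def)
  show "geodesic_dist \<gamma> \<eta> = 0 \<longleftrightarrow> \<gamma> = \<eta>"
  proof
    assume "geodesic_dist \<gamma> \<eta> = 0"
    then have "\<gamma> t = \<eta> t" if "t \<in> {0..1}" for t
      using dist_le_geodesic_dist[OF g that] by simp
    then show "\<gamma> = \<eta>"
      using * by (auto simp: geodesics_from_def intro: extensionalityI)
  qed (simp add: geodesic_dist_def)
next
  fix \<gamma> \<eta> \<zeta>
  assume "\<gamma> \<in> geodesics_from x" "\<eta> \<in> geodesics_from x" "\<zeta> \<in> geodesics_from x"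
  then have g: "const_speed_geodesic \<gamma>" "const_speed_geodesic \<eta>" "const_speed_geodesic \<zeta>"
    by (auto simp: geodesics_from_def)
  have "dist (\<gamma> t) (\<zeta> t) \<le> geodesic_dist \<gamma> \<eta> + geodesic_dist \<eta> \<zeta>" if "t \<in> {0..1}" for t
    using dist_le_geodesic_dist[OF g(1,2) that] dist_le_geodesic_dist[OF g(2,3) that]
      dist_triangle[of "\<gamma> t" "\<zeta> t" "\<eta> t"] by linarith
  then show "geodesic_dist \<gamma> \<zeta> \<le> geodesic_dist \<gamma> \<eta> + geodesic_dist \<eta> \<zeta>"
    using g by (subst geodesic_dist_def) (auto intro: cSUP_least)
qed

definition geodesic_topology :: "'a::metric_space \<Rightarrow> (real \<Rightarrow> 'a) topology" where
  "geodesic_topology x = Metric_space.mtopology (geodesics_from x) geodesic_dist"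

definition geodesically_bounded :: "'a::metric_space \<Rightarrow> (real \<Rightarrow> 'a) set \<Rightarrow> bool" where
  "geodesically_bounded x U \<longleftrightarrow> Metric_space.mbounded (geodesics_from x) geodesic_dist U"

text \<open>
  The limit ``as \<open>y \<rightarrow> x\<close>, \<open>y \<noteq> x\<close>, along \<open>\<gamma>\<close>'' is the limit along the filter \<open>at x\<close> relative to the
  image of \<open>\<gamma>\<close>.
\<close>

definition geodesically_differentiable_along ::
    "('a::metric_space \<Rightarrow> real) \<Rightarrow> 'a \<Rightarrow> (real \<Rightarrow> 'a) \<Rightarrow> bool" where
  "geodesically_differentiable_along f x \<gamma> \<longleftrightarrow>
     (\<exists>l. ((\<lambda>y. (f y - f x) / dist y x) \<longlongrightarrow> l) (at x within \<gamma> ` {0..1}))"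

definition geodesic_deriv :: "('a::metric_space \<Rightarrow> real) \<Rightarrow> 'a \<Rightarrow> (real \<Rightarrow> 'a) \<Rightarrow> real" where
  "geodesic_deriv f x \<gamma> = Lim (at x within \<gamma> ` {0..1}) (\<lambda>y. (f y - f x) / dist y x)"

definition geodesically_differentiable :: "('a::metric_space \<Rightarrow> real) \<Rightarrow> bool" where
  "geodesically_differentiable f \<longleftrightarrow>
     (\<forall>x. \<forall>\<gamma>\<in>nonconst_geodesics_from x. geodesically_differentiable_along f x \<gamma>)"

end

theory Submission
  imports Defs
begin

text \<open>
  The set of geodesics issuing from \<open>x\<close> is a copy of the space itself. By comparison with a
  Euclidean triangle, where the intercept theorem holds, the points at time \<open>t\<close> on two geodesics
  from \<open>x\<close> in a \<open>CAT(0)\<close> space have a distance of at most \<open>t\<close> times the distance of their endpoints. The supremum distance of two geodesics is therefore the distance of their endpoints,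
  and as every point is the endpoint of a geodesic from \<open>x\<close>, the map \<open>\<gamma> \<mapsto> \<gamma> 1\<close> is an isometry
  onto the space (\<open>homeomorphic_map_endpoint\<close>).

  A locally compact Hadamard space is proper, by the Hopf-Rinow theorem
  (\<open>compact_cball_hadamard\<close>): the radii \<open>r\<close> for which the closed ball around \<open>x\<close> is compact form
  an interval that contains its supremum, by completeness and total boundedness, and that can
  always be enlarged, by local compactness. Existence of geodesics enters in both steps, by
  providing for each point of a ball a nearby point of a slightly smaller concentric ball.

  Transporting properness along the isometry shows that closed bounded sets of geodesics are
  compact. Such a set, as long as it avoids the constant geodesic, has a compact image under the
  derivative, which is continuous there; this gives boundedness, and for the unit sphere also
  the extremal directions.
\<close>

section \<open>The space of geodesics from a point\<close>

text \<open>
  The vertices are placed at the origin, on the first axis, and at the intersection point of two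
  circles; \<open>u\<close> is the abscissa of that point, as given by the law of cosines.
\<close>

lemma comparison_triangle_exists:
  fixes p q r :: "'a::metric_space"
  shows "\<exists>p' q' r' :: real^2. dist p' q' = dist p q \<and> dist q' r' = dist q r \<and> dist p' r' = dist p r"
proof (cases "p = q")
  case True
  show ?thesis
    by (rule exI[of _ 0], rule exI[of _ 0], rule exI[of _ "vector [dist p r, 0]"])
       (simp add: True dist_norm norm_vec_def L2_set_def sum_2)
next
  case False
  define a b c where "a = dist p q" and "b = dist q r" and "c = dist p r"
  have a: "a > 0" and b: "b \<ge> 0" and c: "c \<ge> 0"
    using False by (auto simp: a_def b_def c_def)
  have tri: "a \<le> b + c" "b \<le> a + c" "c \<le> a + b"
    unfolding a_def b_def c_def by metric+
  define u where "u = (a\<^sup>2 + c\<^sup>2 - b\<^sup>2) / (2 * a)"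
  have au: "2 * a * u = a\<^sup>2 + c\<^sup>2 - b\<^sup>2"
    using a by (simp add: u_def)
  \<comment> \<open>The law of cosines yields a cosine between \<open>-1\<close> and \<open>1\<close> by the triangle inequalities.\<close>
  have "\<bar>2 * a * u\<bar> \<le> 2 * a * c"
  proof -
    have "(a - c)\<^sup>2 \<le> b\<^sup>2"
      using tri b by (intro abs_le_square_iff[THEN iffD1]) auto
    moreover have "b\<^sup>2 \<le> (a + c)\<^sup>2"
      using tri(2) b by (rule power_mono)
    ultimately show ?thesis
      unfolding au by (auto simp: power2_diff power2_sum)
  qed
  then have "\<bar>u\<bar> \<le> c"
    using a by (simp add: abs_mult)
  then have u2: "u\<^sup>2 \<le> c\<^sup>2"
    by (simp add: abs_le_square_iff[symmetric])
  define q' r' :: "real^2" where "q' = vector [a, 0]" and "r' = vector [u, sqrt (c\<^sup>2 - u\<^sup>2)]"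
  have "dist 0 q' = a" "dist 0 r' = c"
    using a c u2 by (auto simp: dist_norm norm_vec_def L2_set_def sum_2 q'_def r'_def)
  moreover have "dist q' r' = b"
  proof -
    have "(a - u)\<^sup>2 + (c\<^sup>2 - u\<^sup>2) = b\<^sup>2"
      using au by (simp add: power2_diff)
    then show ?thesis
      using b u2 by (simp add: dist_norm norm_vec_def L2_set_def sum_2 q'_def r'_def)
  qed
  ultimately show ?thesis
    unfolding a_def b_def c_def by blast
qed

text \<open>
  In the comparison triangle, the points that divide two sides in the same ratio \<open>t\<close> are the images
  of the endpoints under a homothety with factor \<open>t\<close>.
\<close>

lemma dist_geodesics_same_parameter_le:
  fixes \<gamma> \<eta> :: "real \<Rightarrow> 'a::cat0_space"
  assumes "const_speed_geodesic \<gamma>" "const_speed_geodesic \<eta>" "\<gamma> 0 = \<eta> 0" "t \<in> {0..1}"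
  shows "dist (\<gamma> t) (\<eta> t) \<le> t * dist (\<gamma> 1) (\<eta> 1)"
proof -
  obtain p' q' r' :: "real^2" where tri: "dist p' q' = dist (\<gamma> 0) (\<gamma> 1)"
      "dist q' r' = dist (\<gamma> 1) (\<eta> 1)" "dist p' r' = dist (\<gamma> 0) (\<eta> 1)"
    using comparison_triangle_exists by blast
  have "dist (\<gamma> t) (\<eta> t) \<le> dist ((1 - t) *\<^sub>R p' + t *\<^sub>R q') ((1 - t) *\<^sub>R p' + t *\<^sub>R r')"
    using cat0_comparison[OF assms(1) refl refl assms(2) assms(3)[symmetric] refl tri assms(4,4)] .
  also have "\<dots> = t * dist q' r'"
    using assms(4) by (simp add: dist_norm flip: scaleR_diff_right)
  finally show ?thesis
    by (simp add: tri)
qed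

lemma geodesic_dist_eq_dist_endpoints:
  fixes x :: "'a::cat0_space"
  assumes "\<gamma> \<in> geodesics_from x" "\<eta> \<in> geodesics_from x"
  shows "geodesic_dist \<gamma> \<eta> = dist (\<gamma> 1) (\<eta> 1)"
proof (rule antisym)
  have g: "const_speed_geodesic \<gamma>" "const_speed_geodesic \<eta>" "\<gamma> 0 = \<eta> 0"
    using assms by (auto simp: geodesics_from_def)
  have "dist (\<gamma> t) (\<eta> t) \<le> dist (\<gamma> 1) (\<eta> 1)" if "t \<in> {0..1}" for t
    using dist_geodesics_same_parameter_le[OF g that] that
    by (meson atLeastAtMost_iff mult_left_le_one_le order_trans zero_le_dist)
  then show "geodesic_dist \<gamma> \<eta> \<le> dist (\<gamma> 1) (\<eta> 1)"
    using g by (auto simp: geodesic_dist_def intro: cSUP_least)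
  show "dist (\<gamma> 1) (\<eta> 1) \<le> geodesic_dist \<gamma> \<eta>"
    using dist_le_geodesic_dist[OF g(1,2)] by simp
qed

lemma endpoints_geodesics_from:
  fixes x :: "'a::cat0_space"
  shows "(\<lambda>\<gamma>. \<gamma> 1) ` geodesics_from x = UNIV"
proof (intro set_eqI iffI UNIV_I)
  fix y :: 'a
  obtain \<gamma> where \<gamma>: "const_speed_geodesic \<gamma>" "\<gamma> 0 = x" "\<gamma> 1 = y"
    using geodesic_exists by blast
  have "restrict \<gamma> {0..1} \<in> geodesics_from x"
    using \<gamma> by (simp add: geodesics_from_def const_speed_geodesic_def)
  moreover have "restrict \<gamma> {0..1} 1 = y"
    using \<gamma> by simp
  ultimately show "y \<in> (\<lambda>\<gamma>. \<gamma> 1) ` geodesics_from x"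
    by (metis imageI)
qed

lemma homeomorphic_map_endpoint:
  fixes x :: "'a::cat0_space"
  shows "homeomorphic_map (geodesic_topology x) (euclidean :: 'a topology) (\<lambda>\<gamma>. \<gamma> 1)"
proof -
  interpret Metric_space12 "geodesics_from x" geodesic_dist "UNIV :: 'a set" dist
    by (simp add: Metric_space12_def Metric_space_geodesics_from Met_TC.Metric_space_axioms)
  have "homeomorphic_map M1.mtopology Met_TC.mtopology (\<lambda>\<gamma>. \<gamma> 1)"
    by (rule isometry_imp_homeomorphic_map)
       (auto simp: endpoints_geodesics_from geodesic_dist_eq_dist_endpoints)
  then show ?thesis
    by (simp add: geodesic_topology_def)
qed

section \<open>Properness of locally compact Hadamard spaces\<close>

text \<open>The point sought is the one at distance \<open>r\<close> from \<open>x\<close> on a geodesic from \<open>x\<close> to \<open>y\<close>.\<close>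

lemma geodesic_obtains_point_in_cball:
  fixes x y :: "'a::cat0_space"
  assumes "dist x y \<le> r + e" "0 \<le> r" "0 \<le> e"
  obtains z where "z \<in> cball x r" "dist z y \<le> e"
proof (cases "dist x y \<le> r")
  case True
  then show ?thesis
    using that[of y] assms by auto
next
  case False
  then have pos: "dist x y > 0"
    using assms by linarith
  obtain \<gamma> where \<gamma>: "const_speed_geodesic \<gamma>" "\<gamma> 0 = x" "\<gamma> 1 = y"
    using geodesic_exists by blast
  define t where "t = r / dist x y"
  have t: "t \<in> {0..1}" and tr: "t * dist x y = r"
    using False pos assms by (auto simp: t_def)
  have "dist x (\<gamma> t) = t * dist x y"
    using \<gamma>(1)[unfolded const_speed_geodesic_def, rule_format, of 0 t] t \<gamma>(2,3) by auto
  moreover have "dist (\<gamma> t) y = (1 - t) * dist x y"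
    using \<gamma>(1)[unfolded const_speed_geodesic_def, rule_format, of t 1] t \<gamma>(2,3) by auto
  ultimately show ?thesis
    using assms tr that[of "\<gamma> t"] by (auto simp: algebra_simps)
qed

text \<open>
  A ball that is the limit of compact balls is totally bounded, since a finite \<open>e/2\<close>-net of a ball
  whose radius is smaller by at most \<open>e/2\<close> is an \<open>e\<close>-net of it.
\<close>

lemma compact_cball_limit:
  fixes x :: "'a::hadamard_space"
  assumes "0 \<le> R" "\<And>r. 0 \<le> r \<Longrightarrow> r < R \<Longrightarrow> compact (cball x r)"
  shows "compact (cball x R)"
  unfolding compact_eq_totally_bounded
proof (intro conjI allI impI)
  show "complete (cball x R)"
    by (simp add: complete_eq_closed)
  fix e :: real assume "e > 0"
  show "\<exists>k. finite k \<and> cball x R \<subseteq> (\<Union>y\<in>k. ball y e)"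
  proof (cases "R = 0")
    case True
    then show ?thesis
      using \<open>e > 0\<close> by (intro exI[of _ "{x}"]) auto
  next
    case False
    \<comment> \<open>The maximum keeps the radius nonnegative when \<open>e\<close> is large.\<close>
    define r where "r = max 0 (R - e / 2)"
    have r: "0 \<le> r" "r < R" "R \<le> r + e / 2"
      using False assms(1) \<open>e > 0\<close> by (auto simp: r_def)
    obtain k where k: "finite k" "cball x r \<subseteq> (\<Union>y\<in>k. ball y (e / 2))"
      using assms(2)[OF r(1,2)] \<open>e > 0\<close> unfolding compact_eq_totally_bounded
      by (meson half_gt_zero)
    have "y \<in> (\<Union>w\<in>k. ball w e)" if y: "y \<in> cball x R" for y
    proof -
      obtain z where z: "z \<in> cball x r" "dist z y \<le> e / 2"
        using geodesic_obtains_point_in_cball[of x y r "e / 2"] y r \<open>e > 0\<close> by auto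
      obtain w where w: "w \<in> k" "dist w z < e / 2"
        using k(2) z(1) by auto
      have "dist w y < e"
        using z(2) w(2) dist_triangle[of w y z] by linarith
      then show ?thesis
        using w(1) by auto
    qed
    then show ?thesis
      using k(1) by blast
  qed
qed

lemma locally_compact_obtains_compact_neighbourhood:
  fixes K :: "'a::topological_space set"
  assumes "locally compact (UNIV :: 'a set)" "compact K"
  obtains W C where "open W" "compact C" "K \<subseteq> W" "W \<subseteq> C"
proof -
  have "\<exists>u v. open u \<and> compact v \<and> y \<in> u \<and> u \<subseteq> v" for y :: 'a
    using locallyE[OF assms(1), of UNIV y] by (metis UNIV_I open_openin openin_subtopology_self
        subtopology_UNIV topspace_euclidean)
  then obtain u v :: "'a \<Rightarrow> 'a set" where uv:
      "\<And>y. open (u y)" "\<And>y. compact (v y)" "\<And>y. y \<in> u y" "\<And>y. u y \<subseteq> v y"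
    by metis
  obtain F where F: "finite F" "K \<subseteq> (\<Union>y\<in>F. u y)"
  proof (rule compactE_image[OF assms(2), of UNIV u])
    show "K \<subseteq> (\<Union>y\<in>UNIV. u y)"
      using uv(3) by blast
  qed (use uv(1) in auto)
  show thesis
  proof (rule that)
    show "open (\<Union>y\<in>F. u y)" "compact (\<Union>y\<in>F. v y)"
      using F(1) uv(1,2) by (auto intro: compact_UN)
    show "K \<subseteq> (\<Union>y\<in>F. u y)" "(\<Union>y\<in>F. u y) \<subseteq> (\<Union>y\<in>F. v y)"
      using F(2) uv(4) by (blast, intro UN_mono order_refl)
  qed
qed

text \<open>
  A compact ball has a uniform neighbourhood with compact closure, and the balls of slightly
  larger radius lie in it, because each of their points is close to a point of the given ball.
\<close>

lemma compact_cball_enlarge: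
  fixes x :: "'a::hadamard_space"
  assumes "locally compact (UNIV :: 'a set)" "0 \<le> r" "compact (cball x r)"
  shows "\<exists>s>r. compact (cball x s)"
proof -
  obtain W C where W: "open W" "compact C" "cball x r \<subseteq> W" "W \<subseteq> C"
    using locally_compact_obtains_compact_neighbourhood[OF assms(1,3)] .
  obtain e where e: "e > 0" "(\<Union>z\<in>cball x r. cball z e) \<subseteq> W"
    using compact_subset_open_imp_cball_epsilon_subset[OF assms(3) W(1,3)] .
  have "cball x (r + e) \<subseteq> C"
  proof
    fix y assume "y \<in> cball x (r + e)"
    then obtain z where "z \<in> cball x r" "dist z y \<le> e"
      using geodesic_obtains_point_in_cball[of x y r e] assms(2) e(1) by auto
    then have "y \<in> (\<Union>z\<in>cball x r. cball z e)"
      by auto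
    then show "y \<in> C"
      using e(2) W(4) by blast
  qed
  then have "compact (cball x (r + e))"
    using closed_Int_compact[OF closed_cball W(2), of x "r + e"] by (simp add: inf.absorb1)
  then show ?thesis
    using e(1) by (intro exI[of _ "r + e"]) simp
qed

text \<open>
  This is the Hopf-Rinow argument: if not all balls around \<open>x\<close> were compact, the supremum of the
  radii of the compact ones would belong to a compact ball that still can be enlarged.
\<close>

theorem compact_cball_hadamard:
  fixes x :: "'a::hadamard_space"
  assumes lc: "locally compact (UNIV :: 'a set)"
  shows "compact (cball x r)"
proof (rule ccontr)
  assume nc: "\<not> compact (cball x r)"
  have mono: "compact (cball x s)" if "compact (cball x t)" "s \<le> t" for s t
    using compact_Int_closed[OF that(1) closed_cball[of x s]] subset_cball[OF that(2), of x]
    by (simp add: inf.absorb2)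
  define S where "S = {s. 0 \<le> s \<and> compact (cball x s)}"
  have "0 \<in> S"
    by (simp add: S_def)
  have bdd: "bdd_above S"
  proof (rule bdd_aboveI)
    show "s \<le> r" if "s \<in> S" for s
      using that mono[where s = r and t = s] nc linear[of s r] by (auto simp: S_def)
  qed
  have "0 \<le> Sup S"
    using \<open>0 \<in> S\<close> bdd by (rule cSup_upper)
  moreover have "compact (cball x s)" if s: "s < Sup S" for s
  proof -
    obtain t where "t \<in> S" "s < t"
      using less_cSupD[OF _ s] \<open>0 \<in> S\<close> by blast
    then show ?thesis
      using mono[where s = s and t = t] by (simp add: S_def)
  qed
  ultimately have "compact (cball x (Sup S))"
    by (rule compact_cball_limit)
  then obtain s where s: "s > Sup S" "compact (cball x s)"
    using compact_cball_enlarge[OF lc \<open>0 \<le> Sup S\<close>] by blast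
  then have "s \<in> S"
    using \<open>0 \<le> Sup S\<close> by (simp add: S_def)
  then show False
    using cSup_upper[OF _ bdd, of s] s(1) by simp
qed

lemma closed_bounded_imp_compact_hadamard:
  fixes K :: "'a::hadamard_space set"
  assumes "locally compact (UNIV :: 'a set)" "closed K" "bounded K"
  shows "compact K"
proof -
  obtain x r where "K \<subseteq> cball x r"
    using assms(3) by (metis bounded_subset_cball)
  then show ?thesis
    using closed_Int_compact[OF assms(2) compact_cball_hadamard[OF assms(1)], of x r]
    by (simp add: inf.absorb1)
qed

section \<open>Compact sets of geodesics\<close>

lemma compactin_closed_bounded_geodesics:
  fixes x :: "'a::hadamard_space"
  assumes lc: "locally compact (UNIV :: 'a set)"
    and cl: "closedin (geodesic_topology x) U" and bd: "geodesically_bounded x U"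
  shows "compactin (geodesic_topology x) U"
proof -
  interpret Metric_space "geodesics_from x" geodesic_dist
    by (rule Metric_space_geodesics_from)
  have U: "U \<subseteq> geodesics_from x"
    using bd by (simp add: geodesically_bounded_def mbounded_alt)
  obtain B where B: "\<And>\<gamma> \<eta>. \<gamma> \<in> U \<Longrightarrow> \<eta> \<in> U \<Longrightarrow> geodesic_dist \<gamma> \<eta> \<le> B"
    using bd by (auto simp: geodesically_bounded_def mbounded_alt)
  have top: "topspace (geodesic_topology x) = geodesics_from x"
    by (simp add: geodesic_topology_def)
  have "bounded ((\<lambda>\<gamma>. \<gamma> 1) ` U)"
    unfolding bounded_two_points
    using B U by (intro exI[of _ B]) (auto simp: subset_iff simp flip: geodesic_dist_eq_dist_endpoints[of _ x])
  moreover have "closed ((\<lambda>\<gamma>. \<gamma> 1) ` U)"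
    using homeomorphic_map_closedness_eq[OF homeomorphic_map_endpoint[of x], of U] cl by auto
  ultimately have "compact ((\<lambda>\<gamma>. \<gamma> 1) ` U)"
    using closed_bounded_imp_compact_hadamard[OF lc] by blast
  then show ?thesis
    using homeomorphic_map_compactness_eq[OF homeomorphic_map_endpoint[of x], of U] U top by auto
qed

lemma trivial_geodesic_in_geodesics_from: "trivial_geodesic x \<in> geodesics_from x"
  by (simp add: trivial_geodesic_def geodesics_from_def const_speed_geodesic_def)

lemma compactin_geodesic_unit_sphere:
  fixes x :: "'a::hadamard_space"
  assumes lc: "locally compact (UNIV :: 'a set)"
  shows "compactin (geodesic_topology x) (geodesic_unit_sphere x)"
proof -
  interpret Metric_space "geodesics_from x" geodesic_dist
    by (rule Metric_space_geodesics_from)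
  let ?e = "trivial_geodesic x"
  have "geodesic_unit_sphere x = mcball ?e 1 - mball ?e 1"
    using trivial_geodesic_in_geodesics_from[of x] by (auto simp: geodesic_unit_sphere_def commute)
  then show ?thesis
    using compactin_closed_bounded_geodesics[OF lc, of x "geodesic_unit_sphere x"]
      mbounded_subset[OF mbounded_mcball, of _ ?e 1]
    by (auto simp: geodesic_topology_def geodesically_bounded_def closedin_diff)
qed

lemma compact_image_nonconst_geodesics:
  assumes "continuous_map (subtopology (geodesic_topology x) (nonconst_geodesics_from x)) euclideanreal g"
    and "compactin (geodesic_topology x) U" "U \<subseteq> nonconst_geodesics_from x"
  shows "compact (g ` U)"
  using image_compactin[OF _ assms(1)] assms(2,3) by (simp add: compactin_subtopology)

lemma geodesic_unit_sphere_subset_nonconst: "geodesic_unit_sphere x \<subseteq> nonconst_geodesics_from x"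
proof -
  interpret Metric_space "geodesics_from x" geodesic_dist
    by (rule Metric_space_geodesics_from)
  show ?thesis
    using trivial_geodesic_in_geodesics_from[of x]
    by (auto simp: geodesic_unit_sphere_def nonconst_geodesics_from_def)
qed

section \<open>Extremal directions\<close>

lemma compact_real_image_attains_ereal:
  fixes g :: "'b \<Rightarrow> real"
  assumes "compact (g ` S)" "S \<noteq> {}"
  shows "\<exists>a\<in>S. ereal (g a) = (SUP s\<in>S. ereal (g s))" "\<exists>a\<in>S. ereal (g a) = (INF s\<in>S. ereal (g s))"
proof -
  obtain a where "a \<in> S" "\<And>s. s \<in> S \<Longrightarrow> g s \<le> g a"
    using compact_attains_sup[OF assms(1)] assms(2) by auto
  then show "\<exists>a\<in>S. ereal (g a) = (SUP s\<in>S. ereal (g s))"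
    by (intro bexI[of _ a] antisym SUP_upper SUP_least) auto
  obtain b where "b \<in> S" "\<And>s. s \<in> S \<Longrightarrow> g b \<le> g s"
    using compact_attains_inf[OF assms(1)] assms(2) by auto
  then show "\<exists>a\<in>S. ereal (g a) = (INF s\<in>S. ereal (g s))"
    by (intro bexI[of _ b] antisym INF_lower INF_greatest) auto
qed

theorem theorem12:
  fixes f :: "'a::hadamard_space \<Rightarrow> real"
  assumes "locally compact (UNIV :: 'a set)"
    and "geodesically_differentiable f"
    and "\<And>x. continuous_map
           (subtopology (geodesic_topology x) (nonconst_geodesics_from x)) euclideanreal
           (geodesic_deriv f x)"
  shows "\<forall>x.
    (\<forall>U. U \<subseteq> nonconst_geodesics_from x \<and> closedin (geodesic_topology x) U \<and>
         geodesically_bounded x U \<longrightarrow> bounded (geodesic_deriv f x ` U)) \<and>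
    (geodesic_unit_sphere x \<noteq> {} \<longrightarrow>
      (\<exists>\<gamma>max \<in> geodesic_unit_sphere x. \<exists>\<gamma>min \<in> geodesic_unit_sphere x.
         ereal (geodesic_deriv f x \<gamma>max) =
           (SUP \<gamma>\<in>geodesic_unit_sphere x. ereal (geodesic_deriv f x \<gamma>)) \<and>
         ereal (geodesic_deriv f x \<gamma>min) =
           (INF \<gamma>\<in>geodesic_unit_sphere x. ereal (geodesic_deriv f x \<gamma>))))"
proof (intro allI conjI impI)
  fix x :: 'a and U
  assume U: "U \<subseteq> nonconst_geodesics_from x \<and> closedin (geodesic_topology x) U \<and>
    geodesically_bounded x U"
  then have "compactin (geodesic_topology x) U"
    using compactin_closed_bounded_geodesics[OF assms(1)] by blast
  then have "compact (geodesic_deriv f x ` U)"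
    using compact_image_nonconst_geodesics[OF assms(3)] U by blast
  then show "bounded (geodesic_deriv f x ` U)"
    by (rule compact_imp_bounded)
next
  fix x :: 'a
  let ?S = "geodesic_unit_sphere x"
  assume "?S \<noteq> {}"
  moreover have "compact (geodesic_deriv f x ` ?S)"
    using compact_image_nonconst_geodesics[OF assms(3) compactin_geodesic_unit_sphere[OF assms(1)]
        geodesic_unit_sphere_subset_nonconst] .
  ultimately show "\<exists>\<gamma>max \<in> ?S. \<exists>\<gamma>min \<in> ?S.
      ereal (geodesic_deriv f x \<gamma>max) = (SUP \<gamma>\<in>?S. ereal (geodesic_deriv f x \<gamma>)) \<and>
      ereal (geodesic_deriv f x \<gamma>min) = (INF \<gamma>\<in>?S. ereal (geodesic_deriv f x \<gamma>))"
    using compact_real_image_attains_ereal[of "geodesic_deriv f x" ?S] by blast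
qed

end
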